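(* $\displaystyle\lim_{H\to\infty}\frac{D_3(H)}{H\log H}=4$.
   Context: A polynomial $f\in\mathbb{C}[X]$ is degenerate if it has two distinct roots whose quotient is a root of unity. $D_3(H)$ is the number of monic polynomials $X^3+a_1X^2+a_2X+a_3\in\mathbb{Z}[X]$ that are degenerate with $|a_j|\le H$ for $j=1,2,3$; $H$ runs over positive integers. *)

theory Defs
  imports Complex_Main "HOL-Computational_Algebra.Polynomial"
begin

definition root_of_unity :: "complex \<Rightarrow> bool" where
  "root_of_unity z \<longleftrightarrow> (\<exists>n\<ge>1. z ^ n = 1)"

(* If y = 0 then x / y = 0 in HOL, which is not a root of unity, so the root 0
   never takes part in a degenerate pair. *)
definition degenerate :: "complex poly \<Rightarrow> bool" where
  "degenerate f \<longleftrightarrow>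
     (\<exists>x y. poly f x = 0 \<and> poly f y = 0 \<and> x \<noteq> y \<and> root_of_unity (x / y))"

(* [:a3, a2, a1, 1:] is X^3 + a1 X^2 + a2 X + a3. *)
definition D3 :: "nat \<Rightarrow> nat" where
  "D3 H = card {[:a3, a2, a1, 1:] :: int poly | a1 a2 a3.
     \<bar>a1\<bar> \<le> int H \<and> \<bar>a2\<bar> \<le> int H \<and> \<bar>a3\<bar> \<le> int H \<and>
     degenerate (map_poly of_int [:a3, a2, a1, 1:])}"

end

theory Submission
  imports Defs "HOL-Analysis.Harmonic_Numbers"
begin

text \<open>
  Let \<open>x \<noteq> y\<close> be roots of the cubic \<open>f\<close> with \<open>x\<^sup>n = y\<^sup>n\<close>, and write
  \<open>X\<^sup>n \<equiv> A + B X + C X\<^sup>2\<close> modulo \<open>f\<close>, with integers \<open>A\<close>, \<open>B\<close>, \<open>C\<close>. Subtracting the values at \<open>x\<close> and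
  \<open>y\<close> gives \<open>C (x + y) + B = 0\<close>. If \<open>C \<noteq> 0\<close>, the third root is rational. Otherwise \<open>B = 0\<close>, all roots
  have the same modulus, and complex conjugation shows that either \<open>f = X\<^sup>3 + a\<^sub>3\<close> or \<open>f\<close> again has
  a rational root. So apart from \<open>O(H)\<close> polynomials \<open>f = (X + c) (X\<^sup>2 + p X + q)\<close> over the
  integers, and unless \<open>c\<close> and \<open>-c\<close> are both roots, the roots \<open>u, v\<close> of the quadratic factor form a degenerate
  pair. With \<open>w = u / v\<close>, the number \<open>w + 1 / w = p\<^sup>2 / q - 2\<close> is a rational algebraic integer in
  \<open>[-2, 2)\<close>, hence \<open>p\<^sup>2 = k q\<close> with \<open>k \<in> {0, 1, 2, 3}\<close>.

  For \<open>k \<noteq> 0\<close> the bound \<open>\<bar>c\<bar> p\<^sup>2 \<le> 3 H\<close> leaves only \<open>O(H)\<close> polynomials. The polynomials with opposite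
  roots are those with \<open>a\<^sub>1 a\<^sub>2 = a\<^sub>3\<close> and \<open>a\<^sub>2 \<noteq> 0\<close>; there are \<open>4 \<Sum>\<^bsub>m \<le> H\<^esub> \<lfloor>H / m\<rfloor> + O(H)\<close> of them.
\<close>

section \<open>Degenerate integer cubics\<close>

lemma rational_root_of_monic_int_poly:
  fixes x :: complex
  assumes "x \<in> \<rat>" "lead_coeff p = 1" "\<And>i. coeff p i \<in> \<int>" "poly p x = 0"
  shows "x \<in> \<int>"
  using assms algebraic_int.intros rational_algebraic_int_is_int by blast

lemma rational_root_cubic:
  fixes z :: complex and a1 a2 a3 :: int
  assumes "z \<in> \<rat>" "z ^ 3 + of_int a1 * z\<^sup>2 + of_int a2 * z + of_int a3 = 0"
  shows "z \<in> \<int>"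
proof (rule rational_root_of_monic_int_poly[OF assms(1), of "[:of_int a3, of_int a2, of_int a1, 1:]"])
  show "poly [:of_int a3, of_int a2, of_int a1, 1:] z = 0"
    using assms(2) by (simp add: algebra_simps power2_eq_square power3_eq_cube)
qed (auto simp: coeff_pCons split: nat.splits)

text \<open>Reduction of \<open>X ^ n\<close> by the monic cubic keeps the coefficients integral.
  The same \<open>A\<close>, \<open>B\<close>, \<open>C\<close> serve all roots, so values at
  different roots can be compared.\<close>

lemma power_mod_monic_cubic:
  fixes a1 a2 a3 :: int
  shows "\<exists>A B C :: int. \<forall>x :: complex. x ^ 3 + of_int a1 * x\<^sup>2 + of_int a2 * x + of_int a3 = 0 \<longrightarrow>
           x ^ n = of_int A + of_int B * x + of_int C * x\<^sup>2"
proof (induction n)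
  case 0
  have "\<forall>x :: complex. x ^ 0 = of_int 1 + of_int 0 * x + of_int 0 * x\<^sup>2" by simp
  then show ?case by blast
next
  case (Suc n)
  then obtain A B C :: int where ABC: "\<And>x :: complex. x ^ 3 + of_int a1 * x\<^sup>2 + of_int a2 * x + of_int a3 = 0 \<Longrightarrow>
           x ^ n = of_int A + of_int B * x + of_int C * x\<^sup>2" by blast
  have "x ^ Suc n = of_int (- C * a3) + of_int (A - C * a2) * x + of_int (B - C * a1) * x\<^sup>2"
    if x: "x ^ 3 + of_int a1 * x\<^sup>2 + of_int a2 * x + of_int a3 = 0" for x :: complex
  proof -
    have x3: "x ^ 3 = - of_int a1 * x\<^sup>2 - of_int a2 * x - of_int a3"
      using x by algebra
    have "x ^ Suc n = of_int A * x + of_int B * x\<^sup>2 + of_int C * x ^ 3"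
      unfolding power_Suc ABC[OF x] by algebra
    also have "\<dots> = of_int (- C * a3) + of_int (A - C * a2) * x + of_int (B - C * a1) * x\<^sup>2"
      unfolding x3 by (simp add: algebra_simps)
    finally show ?thesis .
  qed
  then show ?case by blast
qed

text \<open>Taking \<open>z\<close> from the sum of the roots avoids any appeal to algebraic
  closedness: the other two relations follow by dividing the difference of the two equations by
  \<open>x - y\<close>. The root \<open>z\<close> may coincide with \<open>x\<close> or
  \<open>y\<close>.\<close>

lemma cubic_third_root:
  fixes x y :: "'a :: field"
  assumes "x ^ 3 + a1 * x\<^sup>2 + a2 * x + a3 = 0" "y ^ 3 + a1 * y\<^sup>2 + a2 * y + a3 = 0" "x \<noteq> y"
  obtains z where "a1 = - (x + y + z)" "a2 = x * y + y * z + z * x" "a3 = - (x * y * z)"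
proof
  define z where "z = - a1 - x - y"
  show a1: "a1 = - (x + y + z)" by (simp add: z_def)
  have "(x - y) * (x\<^sup>2 + x * y + y\<^sup>2 + a1 * (x + y) + a2) = 0"
    using assms(1,2) by algebra
  then have *: "x\<^sup>2 + x * y + y\<^sup>2 + a1 * (x + y) + a2 = 0"
    using assms(3) by simp
  show a2: "a2 = x * y + y * z + z * x"
    using * a1 by algebra
  show "a3 = - (x * y * z)"
    using a1 a2 assms(1) by algebra
qed

text \<open>With \<open>R\<close> the common squared modulus, conjugation sends each root to
  \<open>R\<close> divided by it and fixes the integer coefficients. This gives
  \<open>a2 * R = a3 * a1\<close> and \<open>a3^2 = R^3\<close>, so \<open>- a3 / R\<close> is a
  root; it equals \<open>- a2 / a1\<close> if \<open>a1\<close> is nonzero.\<close>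

lemma cubic_roots_equal_norm:
  fixes x y z :: complex and a1 a2 a3 :: int
  assumes vieta: "of_int a1 = - (x + y + z)" "of_int a2 = x * y + y * z + z * x" "of_int a3 = - (x * y * z)"
    and norm: "norm y = norm x" "norm z = norm x"
    and "x \<noteq> 0"
  shows "a1 = 0 \<and> a2 = 0 \<or> (\<exists>s\<in>\<rat>. s ^ 3 + of_int a1 * s\<^sup>2 + of_int a2 * s + of_int a3 = (0 :: complex))"
proof -
  define R where "R = (of_real ((norm x)\<^sup>2) :: complex)"
  have "R \<noteq> 0" using \<open>x \<noteq> 0\<close> by (simp add: R_def)
  have xyz: "x * cnj x = R" "y * cnj y = R" "z * cnj z = R"
    unfolding R_def by (metis complex_norm_square norm)+
  have "cnj (of_int a1) = cnj (- (x + y + z))" using vieta(1) by simp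
  then have a1: "of_int a1 = - (cnj x + cnj y + cnj z)" by simp
  have "cnj (of_int a3) = cnj (- (x * y * z))" using vieta(3) by simp
  then have a3': "of_int a3 = - (cnj x * cnj y * cnj z)" by simp
  have a3: "of_int a3 * of_int a3 = R * R * R"
    using vieta(3) a3' xyz by algebra
  have e: "of_int a2 * R = of_int a3 * of_int a1"
    using vieta(2,3) xyz a1 by algebra
  define s where "s = of_int a3 / R"
  have sR: "s * R = of_int a3" using \<open>R \<noteq> 0\<close> by (simp add: s_def)
  have s2: "s * s = R" using a3 sR \<open>R \<noteq> 0\<close>
    by (simp add: s_def)
  have sa: "of_int a2 = s * of_int a1"
    using e \<open>R \<noteq> 0\<close> by (simp add: s_def field_simps)
  show ?thesis
  proof (cases "a1 = 0")
    case True
    then show ?thesis using sa by simp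
  next
    case False
    then have "s = of_int a2 / of_int a1" using sa by simp
    then have "s \<in> \<rat>" by simp
    then have "- s \<in> \<rat>" by simp
    moreover have "(- s) ^ 3 + of_int a1 * (- s)\<^sup>2 + of_int a2 * (- s) + of_int a3 = 0"
      unfolding sa sR[symmetric] s2[symmetric] by (simp add: power2_eq_square power3_eq_cube)
    ultimately show ?thesis by blast
  qed
qed

lemma norm_eq_of_power_eq:
  fixes x y :: complex
  assumes "x ^ n = y ^ n" "n \<ge> 1"
  shows "norm x = norm y"
proof (rule power_eq_imp_eq_base)
  show "norm x ^ n = norm y ^ n" using assms(1) by (simp flip: norm_power)
qed (use assms(2) in auto)

lemma degenerate_cubic_integer_root:
  fixes x y :: complex and a1 a2 a3 :: int
  assumes x: "x ^ 3 + of_int a1 * x\<^sup>2 + of_int a2 * x + of_int a3 = 0"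
    and y: "y ^ 3 + of_int a1 * y\<^sup>2 + of_int a2 * y + of_int a3 = 0"
    and xy: "x \<noteq> y" "y \<noteq> 0" "x ^ n = y ^ n" "n \<ge> 1"
  shows "a1 = 0 \<and> a2 = 0 \<or> (\<exists>s\<in>\<int>. s ^ 3 + of_int a1 * s\<^sup>2 + of_int a2 * s + of_int a3 = (0 :: complex))"
proof -
  obtain z where vieta: "of_int a1 = - (x + y + z)" "of_int a2 = x * y + y * z + z * x" "of_int a3 = - (x * y * z)"
    using cubic_third_root[OF x y xy(1)] by blast
  have z: "z ^ 3 + of_int a1 * z\<^sup>2 + of_int a2 * z + of_int a3 = 0"
    using vieta by algebra
  obtain A B C :: int where ABC: "\<And>x :: complex. x ^ 3 + of_int a1 * x\<^sup>2 + of_int a2 * x + of_int a3 = 0 \<Longrightarrow>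
           x ^ n = of_int A + of_int B * x + of_int C * x\<^sup>2"
    using power_mod_monic_cubic by blast
  have "of_int A + of_int B * x + of_int C * x\<^sup>2 = of_int A + of_int B * y + of_int C * y\<^sup>2"
    using ABC[OF x] ABC[OF y] xy(3) by simp
  then have "(x - y) * (of_int C * (x + y) + of_int B) = 0" by algebra
  then have BC: "of_int C * (x + y) + of_int B = 0" using xy(1) by simp
  have "a1 = 0 \<and> a2 = 0 \<or> (\<exists>s\<in>\<rat>. s ^ 3 + of_int a1 * s\<^sup>2 + of_int a2 * s + of_int a3 = (0 :: complex))"
  proof (cases "C = 0")
    case False
    have "x + y = - of_int B / of_int C" using BC False
      by (metis add_eq_0_iff2 nonzero_mult_div_cancel_left of_int_eq_0_iff)
    then have "z = - of_int a1 + of_int B / of_int C" using vieta(1) by (simp add: algebra_simps)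
    then have "z \<in> \<rat>" by simp
    then show ?thesis using z by blast
  next
    case True
    then have "B = 0" using BC by simp
    \<comment> \<open>With \<open>B = C = 0\<close> the \<open>n\<close>-th power takes the value
      \<open>A\<close> at every root, hence also at \<open>z\<close>.\<close>
    with True ABC[OF x] ABC[OF z] have "z ^ n = x ^ n" by simp
    then have nz: "norm z = norm x" using xy(4) by (rule norm_eq_of_power_eq)
    have ny: "norm y = norm x" using norm_eq_of_power_eq[OF xy(3,4)] by simp
    with xy(2) have "x \<noteq> 0" by auto
    from cubic_roots_equal_norm[OF vieta ny nz this] show ?thesis .
  qed
  then show ?thesis using rational_root_cubic by blast
qed

section \<open>Roots of unity and degenerate quadratics\<close>

text \<open>These are the Chebyshev polynomials, normalised to be monic.\<close>
lemma monic_int_poly_plus_inverse: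
  "\<exists>P Q :: complex poly. degree P = Suc k \<and> lead_coeff P = 1 \<and> degree Q \<le> k \<and>
     (\<forall>i. coeff P i \<in> \<int> \<and> coeff Q i \<in> \<int>) \<and>
     (\<forall>w. w \<noteq> 0 \<longrightarrow> poly P (w + inverse w) = w ^ Suc k + inverse w ^ Suc k \<and>
       poly Q (w + inverse w) = w ^ k + inverse w ^ k)"
proof (induction k)
  case 0
  show ?case
    \<comment> \<open>At \<open>k = 0\<close> the polynomial \<open>Q\<close> is the constant 2,
      which is why only \<open>P\<close> is claimed to be monic.\<close>
    by (rule exI[of _ "[:0, 1:]"], rule exI[of _ "[:2:]"]) (auto simp: coeff_pCons split: nat.splits)
next
  case (Suc k)
  then obtain P Q :: "complex poly" where P: "degree P = Suc k" "lead_coeff P = 1" and Q: "degree Q \<le> k"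
    and ints: "\<And>i. coeff P i \<in> \<int>" "\<And>i. coeff Q i \<in> \<int>"
    and eq: "\<And>w. w \<noteq> 0 \<Longrightarrow> poly P (w + inverse w) = w ^ Suc k + inverse w ^ Suc k"
       "\<And>w. w \<noteq> 0 \<Longrightarrow> poly Q (w + inverse w) = w ^ k + inverse w ^ k" by blast
  \<comment> \<open>The three-term recurrence: multiply by \<open>w + inverse w\<close> and subtract
    the preceding polynomial.\<close>
  define S where "S = pCons 0 P - Q"
  have "P \<noteq> 0" using P by auto
  then have "degree Q < degree (pCons 0 P)" using P Q by simp
  then have "degree (pCons 0 P + - Q) = degree (pCons 0 P)"
    by (intro degree_add_eq_left) simp
  then have deg: "degree S = Suc (Suc k)" using P(1) \<open>P \<noteq> 0\<close> by (simp add: S_def)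
  have "coeff Q (Suc (Suc k)) = 0" using Q by (intro coeff_eq_0) auto
  then have "lead_coeff S = 1" unfolding deg using P unfolding S_def by simp
  moreover have "\<forall>i. coeff S i \<in> \<int>"
    using ints by (auto simp: S_def coeff_pCons split: nat.splits)
  moreover have "poly S (w + inverse w) = w ^ Suc (Suc k) + inverse w ^ Suc (Suc k)"
    if "w \<noteq> 0" for w :: complex
  proof -
    have "poly S (w + inverse w) = (w + inverse w) * (w ^ Suc k + inverse w ^ Suc k) - (w ^ k + inverse w ^ k)"
      using eq[OF that] by (simp add: S_def del: power_Suc)
    also have "\<dots> = w ^ Suc (Suc k) + inverse w ^ Suc (Suc k)"
      using that by (simp add: field_simps)
    finally show ?thesis .
  qed
  moreover have "degree P \<le> Suc k" using P by simp
  ultimately show ?case using eq(1) deg ints(1) by blast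
qed

text \<open>\<open>w + inverse w\<close> is a root of the monic integer polynomial
  \<open>P - 2\<close>, so being rational it is an integer. It is at most 2 in modulus because
  \<open>norm w = 1\<close>, and the value 2 would force \<open>w = 1\<close>.\<close>

lemma root_of_unity_plus_inverse_rational:
  fixes w :: complex
  assumes "w ^ n = 1" "n \<ge> 1" "w + inverse w \<in> \<rat>" "w \<noteq> 1"
  shows "w + inverse w \<in> {-2, -1, 0, 1}"
proof -
  have "w \<noteq> 0" using assms by (auto simp: power_0_left)
  obtain k where k: "n = Suc k" using assms(2) by (cases n) auto
  obtain P :: "complex poly" where P: "degree P = Suc k" "lead_coeff P = 1"
    "\<And>i. coeff P i \<in> \<int>" "poly P (w + inverse w) = w ^ n + inverse w ^ n"
    using monic_int_poly_plus_inverse[of k] \<open>w \<noteq> 0\<close> k by blast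
  have "inverse w ^ n = 1" using assms(1) by (simp add: power_inverse)
  then have P2: "poly P (w + inverse w) = 2"
    using P(4) assms(1) by simp
  have "degree (P + - [:2:]) = degree P"
    using P(1) by (intro degree_add_eq_left) simp
  then have deg: "degree (P - [:2:]) = Suc k" using P(1) by (simp only: diff_conv_add_uminus)
  have "w + inverse w \<in> \<int>"
  proof (rule rational_root_of_monic_int_poly[OF assms(3)])
    show "lead_coeff (P - [:2:]) = 1" using P unfolding deg by simp
    show "coeff (P - [:2:]) i \<in> \<int>" for i using P(3) by (auto simp: coeff_pCons split: nat.splits)
    show "poly (P - [:2:]) (w + inverse w) = 0" using P2 by simp
  qed
  then obtain t :: int where t: "w + inverse w = of_int t" by (elim Ints_cases)
  have nw: "norm w = 1" using norm_eq_of_power_eq[of w n 1] assms(1,2) by simp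
  have "norm (of_int t :: complex) \<le> 1 + 1"
    unfolding t[symmetric] by (rule norm_triangle_le) (simp add: nw norm_inverse)
  then have "\<bar>t\<bar> \<le> 2" by simp
  moreover have "t \<noteq> 2"
  proof
    assume "t = 2"
    then have "(w - 1) ^ 2 = 0" using t \<open>w \<noteq> 0\<close> by (simp add: field_simps power2_eq_square)
    then show False using assms(4) by simp
  qed
  ultimately have "t \<in> {-2, -1, 0, 1}" by auto
  then show ?thesis using t by auto
qed

text \<open>For \<open>w = u / v\<close> one has \<open>w + inverse w = p^2 / q - 2\<close>, so the
  four admissible values -2, -1, 0, 1 correspond to \<open>k\<close> = 0, 1, 2, 3.\<close>

lemma degenerate_quadratic:
  fixes u v :: complex and p q :: int
  assumes "u + v = - of_int p" "u * v = of_int q" "u \<noteq> v" "v \<noteq> 0" "u ^ n = v ^ n" "n \<ge> 1"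
  shows "\<exists>k\<in>{0, 1, 2, 3}. p\<^sup>2 = k * q"
proof -
  have "norm u = norm v" using assms(5,6) by (rule norm_eq_of_power_eq)
  then have "u \<noteq> 0" using assms(4) by auto
  define w where "w = u / v"
  have wi: "inverse w = v / u" by (simp add: w_def)
  have w: "w + inverse w = of_int (p\<^sup>2) / of_int q - 2"
  proof -
    have "of_int (p\<^sup>2) = (u + v)\<^sup>2" by (simp add: assms(1))
    then show ?thesis unfolding wi unfolding w_def assms(2)[symmetric]
      using \<open>u \<noteq> 0\<close> \<open>v \<noteq> 0\<close> by (simp add: field_simps power2_eq_square)
  qed
  have "w + inverse w \<in> \<rat>" unfolding w by simp
  moreover have "w ^ n = 1" using assms by (simp add: w_def power_divide)
  moreover have "w \<noteq> 1" using assms by (simp add: w_def)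
  ultimately have "w + inverse w \<in> {-2, -1, 0, 1}"
    using root_of_unity_plus_inverse_rational assms(6) by blast
  then have "of_int (p\<^sup>2) / of_int q \<in> {0, 1, 2, 3 :: complex}" unfolding w by auto
  moreover have "(of_int q :: complex) \<noteq> 0" using \<open>u \<noteq> 0\<close> \<open>v \<noteq> 0\<close> by (simp flip: assms(2))
  ultimately have "(of_int (p\<^sup>2) :: complex) \<in> {of_int (0 * q), of_int (1 * q), of_int (2 * q), of_int (3 * q)}"
    by (auto simp: field_simps)
  then show ?thesis unfolding of_int_eq_iff insert_iff by auto
qed

section \<open>Classification of degenerate cubics\<close>

text \<open>The condition \<open>a1 * a2 = a3\<close> says that the cubic is
  \<open>(X + a1) (X^2 + a2)\<close>; it absorbs both the case \<open>k = 0\<close> and the case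
  that \<open>c\<close> and \<open>-c\<close> are roots.\<close>

lemma degenerate_cubic_classification:
  fixes x y :: complex and a1 a2 a3 :: int
  assumes x: "x ^ 3 + of_int a1 * x\<^sup>2 + of_int a2 * x + of_int a3 = 0"
    and y: "y ^ 3 + of_int a1 * y\<^sup>2 + of_int a2 * y + of_int a3 = 0"
    and xy: "x \<noteq> y" "y \<noteq> 0" "x ^ n = y ^ n" "n \<ge> 1"
  shows "a1 = 0 \<and> a2 = 0 \<or> a1 * a2 = a3 \<or>
    (\<exists>c p q. \<exists>k\<in>{1, 2, 3}. p\<^sup>2 = k * q \<and> a1 = c + p \<and> a2 = c * p + q \<and> a3 = c * q)"
    (is "?A \<or> ?B \<or> ?C")
proof (cases ?A)
  case False
  then obtain s :: complex where s: "s \<in> \<int>" "s ^ 3 + of_int a1 * s\<^sup>2 + of_int a2 * s + of_int a3 = 0"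
    using degenerate_cubic_integer_root[OF assms] by blast
  then obtain d :: int where d: "s = of_int d" by (elim Ints_cases)
  define c p q where "c = - d" and "p = a1 - c" and "q = a2 - c * p"
  have "of_int (d ^ 3 + a1 * d\<^sup>2 + a2 * d + a3) = (0 :: complex)" using s(2) d by simp
  then have d0: "d ^ 3 + a1 * d\<^sup>2 + a2 * d + a3 = 0" by (simp only: of_int_eq_0_iff)
  have a1: "a1 = c + p" and a2: "a2 = c * p + q" by (simp_all add: p_def q_def)
  have a3: "a3 = c * q"
    using d0 unfolding q_def p_def c_def by (simp add: algebra_simps power2_eq_square power3_eq_cube)
  have fact: "t = - of_int c \<or> t\<^sup>2 + of_int p * t + of_int q = 0"
    if "t ^ 3 + of_int a1 * t\<^sup>2 + of_int a2 * t + of_int a3 = 0" for t :: complex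
  proof -
    have "(t + of_int c) * (t\<^sup>2 + of_int p * t + of_int q) = 0"
      using that unfolding a1 a2 a3 of_int_add of_int_mult by algebra
    then show ?thesis by (auto simp: eq_neg_iff_add_eq_0)
  qed
  \<comment> \<open>Both members of the degenerate pair are roots of the quadratic factor.\<close>
  have two: "?B \<or> ?C"
    if uv: "u\<^sup>2 + of_int p * u + of_int q = 0" "v\<^sup>2 + of_int p * v + of_int q = 0" "u \<noteq> v" "v \<noteq> 0" "u ^ n = v ^ n"
    for u v :: complex
  proof -
    have "(u - v) * (u + v + of_int p) = 0" using uv(1,2) by algebra
    then have sum: "u + v = - of_int p" using uv(3) by (simp add: eq_neg_iff_add_eq_0)
    have prod: "u * v = of_int q" using uv(1) sum by algebra
    obtain k where k: "k \<in> {0, 1, 2, 3}" "p\<^sup>2 = k * q"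
      using degenerate_quadratic[OF sum prod uv(3-5) xy(4)] by blast
    show ?thesis
    proof (cases "k = 0")
      case True
      then show ?thesis using k a1 a2 a3 by simp
    next
      case False
      then have "k \<in> {1, 2, 3}" using k by simp
      then show ?thesis using k(2) a1 a2 a3 by blast
    qed
  qed
  \<comment> \<open>One member of the pair is \<open>-c\<close>. If \<open>u\<close> is not real,
    conjugating \<open>u ^ n = (-c) ^ n\<close> makes \<open>u\<close>, \<open>cnj u\<close> a
    degenerate pair of the quadratic factor; if \<open>u\<close> is real, equal moduli leave only
    \<open>u = c\<close>.\<close>
  have one: "?B \<or> ?C"
    if u: "u\<^sup>2 + of_int p * u + of_int q = 0" "u \<noteq> - of_int c" "c \<noteq> 0" "u ^ n = (- of_int c) ^ n"
    for u :: complex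
  proof (cases "cnj u = u")
    case False
    have "cnj (u\<^sup>2 + of_int p * u + of_int q) = cnj 0" using u(1) by simp
    then have F: "(cnj u)\<^sup>2 + of_int p * cnj u + of_int q = 0" by simp
    have "(cnj u) ^ n = cnj (u ^ n)" by simp
    also have "\<dots> = u ^ n" unfolding u(4) by simp
    finally have "u ^ n = (cnj u) ^ n" by simp
    moreover have "u \<noteq> 0" using u(3,4) xy(4) by (auto simp: power_0_left)
    ultimately show ?thesis using two[OF u(1) F] False by auto
  next
    case True
    then have "u \<in> \<real>" by (simp add: Reals_cnj_iff)
    then obtain r where r: "u = of_real r" by (elim Reals_cases)
    have "norm u = norm (- of_int c :: complex)" using u(4) xy(4) by (rule norm_eq_of_power_eq)
    then have "\<bar>r\<bar> = \<bar>of_int c\<bar>" by (simp add: r)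
    moreover have "r \<noteq> - of_int c" using u(2) r by auto
    ultimately have "r = of_int c" by linarith
    then have "u = of_int c" using r by simp
    then have "of_int (c\<^sup>2 + p * c + q) = (0 :: complex)" using u(1) by simp
    then have "c\<^sup>2 + p * c + q = 0" by (simp only: of_int_eq_0_iff)
    then have "(c + p) * (c * p + q) = c * q" by algebra
    then show ?thesis unfolding a1 a2 a3 by blast
  qed
  have c: "x = - of_int c \<Longrightarrow> c \<noteq> 0" "y = - of_int c \<Longrightarrow> c \<noteq> 0"
    using xy by (auto simp: power_0_left)
  show ?thesis
    using fact[OF x]
  proof
    assume xc: "x = - of_int c"
    then have "y \<noteq> - of_int c" using xy(1) by simp
    then have "y\<^sup>2 + of_int p * y + of_int q = 0" using fact[OF y] by simp
    then have "?B \<or> ?C"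
      using one[of y] \<open>y \<noteq> - of_int c\<close> c(1)[OF xc] xy(3) unfolding xc by simp
    then show ?thesis by simp
  next
    assume xF: "x\<^sup>2 + of_int p * x + of_int q = 0"
    from fact[OF y] have "?B \<or> ?C"
    proof
      assume yc: "y = - of_int c"
      then show ?thesis
        using one[OF xF] c(2)[OF yc] xy(1,3) by simp
    next
      assume "y\<^sup>2 + of_int p * y + of_int q = 0"
      then show ?thesis using two[OF xF] xy by simp
    qed
    then show ?thesis by simp
  qed
qed auto

section \<open>Counting\<close>

text \<open>Clearing the denominator makes \<open>y \<noteq> 0\<close> explicit: since
  \<open>x / 0 = 0\<close>, no positive power of the quotient is 1 when
  \<open>y = 0\<close>.\<close>

lemma degenerate_int_cubic_iff:
  fixes a1 a2 a3 :: int
  shows "degenerate (map_poly of_int [:a3, a2, a1, 1:]) \<longleftrightarrow>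
    (\<exists>(x::complex) y n. x ^ 3 + of_int a1 * x\<^sup>2 + of_int a2 * x + of_int a3 = 0 \<and>
      y ^ 3 + of_int a1 * y\<^sup>2 + of_int a2 * y + of_int a3 = 0 \<and> x \<noteq> y \<and> y \<noteq> 0 \<and> x ^ n = y ^ n \<and> n \<ge> 1)"
proof -
  have *: "poly (map_poly of_int [:a3, a2, a1, 1:]) x = x ^ 3 + of_int a1 * x\<^sup>2 + of_int a2 * x + of_int a3"
    for x :: complex
    by (simp add: map_poly_pCons power2_eq_square power3_eq_cube algebra_simps)
  have **: "root_of_unity (x / y) \<longleftrightarrow> y \<noteq> 0 \<and> (\<exists>n\<ge>1. x ^ n = y ^ n)" for x y
    by (cases "y = 0") (auto simp: root_of_unity_def power_divide power_0_left)
  show ?thesis unfolding degenerate_def * ** by blast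
qed

section \<open>Pairs of nonzero integers below a hyperbola\<close>

definition nonzero_upto :: "nat \<Rightarrow> int set" where
  "nonzero_upto N = {c. c \<noteq> 0 \<and> \<bar>c\<bar> \<le> int N}"

lemma finite_nonzero_upto [simp]: "finite (nonzero_upto N)"
  by (rule finite_subset[of _ "{- int N..int N}"]) (auto simp: nonzero_upto_def)

lemma sum_nonzero_upto:
  fixes g :: "nat \<Rightarrow> nat"
  shows "(\<Sum>c\<in>nonzero_upto N. g (nat \<bar>c\<bar>)) = 2 * (\<Sum>m = 1..N. g m)"
proof (induction N)
  case 0
  have "nonzero_upto 0 = {}" by (auto simp: nonzero_upto_def)
  then show ?case by simp
next
  case (Suc N)
  have "nonzero_upto (Suc N) = insert (int (Suc N)) (insert (- int (Suc N)) (nonzero_upto N))"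
    by (auto simp: nonzero_upto_def)
  moreover have "int (Suc N) \<notin> insert (- int (Suc N)) (nonzero_upto N)" "- int (Suc N) \<notin> nonzero_upto N"
    by (auto simp: nonzero_upto_def)
  moreover have "nat \<bar>int (Suc N)\<bar> = Suc N" "nat \<bar>- int (Suc N)\<bar> = Suc N" by simp_all
  ultimately have "(\<Sum>c\<in>nonzero_upto (Suc N). g (nat \<bar>c\<bar>)) = g (Suc N) + (g (Suc N) + (\<Sum>c\<in>nonzero_upto N. g (nat \<bar>c\<bar>)))"
    by (simp only: sum.insert finite_insert finite_nonzero_upto not_False_eq_True)
  then show ?case using Suc by simp
qed

lemma card_nonzero_upto: "card (nonzero_upto N) = 2 * N"
  using sum_nonzero_upto[of "\<lambda>_. 1" N] by simp

text \<open>For each \<open>m = \<bar>p\<bar>\<close> the value \<open>\<bar>c\<bar>\<close> runs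
  from 1 to \<open>N div f m\<close>, and the signs contribute the factor 4. The bound
  \<open>m \<le> f m\<close> confines \<open>\<bar>p\<bar>\<close> to at most \<open>N\<close>. The
  choice \<open>f m = m\<close> gives the main term, \<open>f m = m^2\<close> the error
  term.\<close>

lemma card_pairs_below_hyperbola:
  fixes f :: "nat \<Rightarrow> nat" and N :: nat
  assumes "\<And>m. m \<le> f m"
  defines "S \<equiv> {(p, c). p \<noteq> 0 \<and> c \<noteq> 0 \<and> int (f (nat \<bar>p\<bar>)) * \<bar>c\<bar> \<le> int N}"
  shows "finite S" "card S = 4 * (\<Sum>m = 1..N. N div f m)"
proof -
  have "int (f (nat \<bar>p\<bar>)) * \<bar>c\<bar> \<le> int N \<longleftrightarrow> \<bar>p\<bar> \<le> int N \<and> \<bar>c\<bar> \<le> int (N div f (nat \<bar>p\<bar>))"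
    if "p \<noteq> 0" "c \<noteq> 0" for p c
  proof -
    define m d where "m = nat \<bar>p\<bar>" and "d = nat \<bar>c\<bar>"
    have md: "\<bar>p\<bar> = int m" "\<bar>c\<bar> = int d" "m > 0" "d > 0" using that by (auto simp: m_def d_def)
    have fm: "f m > 0" using assms(1)[of m] md by linarith
    have 1: "f m * d \<le> N \<longleftrightarrow> d \<le> N div f m"
      using fm by (simp add: less_eq_div_iff_mult_less_eq mult.commute)
    have 2: "m \<le> N" if "f m * d \<le> N"
    proof -
      have "f m * 1 \<le> f m * d" using md by (intro mult_le_mono) auto
      then show ?thesis using that assms(1)[of m] by linarith
    qed
    have "int (f m) * int d \<le> int N \<longleftrightarrow> f m * d \<le> N" by (simp flip: of_nat_mult)
    then show ?thesis using 1 2 md by (auto simp flip: m_def)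
  qed
  then have S: "S = Sigma (nonzero_upto N) (\<lambda>p. nonzero_upto (N div f (nat \<bar>p\<bar>)))"
    unfolding S_def nonzero_upto_def by auto
  show "finite S" unfolding S by simp
  show "card S = 4 * (\<Sum>m = 1..N. N div f m)"
    unfolding S using sum_nonzero_upto[of "\<lambda>m. 2 * (N div f m)" N]
    by (simp add: card_SigmaI card_nonzero_upto flip: sum_distrib_left)
qed

section \<open>Estimates for sums of quotients\<close>

lemma sum_inverse_squares_le: "(\<Sum>m = 1..N. 1 / (real m)\<^sup>2) \<le> 2"
proof (cases "N \<ge> 1")
  case True
  \<comment> \<open>The sharper bound \<open>2 - 1 / N\<close> lets the induction telescope.\<close>
  then have "(\<Sum>m = 1..N. 1 / (real m)\<^sup>2) \<le> 2 - 1 / real N"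
  proof (induction N rule: dec_induct)
    case (step N)
    have "1 / (real (Suc N))\<^sup>2 \<le> 1 / (real N * real (Suc N))"
      using step(1) by (intro divide_left_mono) (auto simp: power2_eq_square)
    also have "\<dots> = 1 / real N - 1 / real (Suc N)"
      using step(1) by (simp add: field_simps)
    finally have "1 / (real (Suc N))\<^sup>2 \<le> 1 / real N - 1 / real (Suc N)" .
    then show ?case using step by simp
  qed simp
  also have "\<dots> \<le> 2" by simp
  finally show ?thesis .
qed simp

text \<open>Convergence of the inverse squares keeps any logarithm out of the families with nonzero
  \<open>k\<close>.\<close>

lemma sum_div_squares_le: "(\<Sum>m = 1..N. N div m\<^sup>2) \<le> 2 * (N :: nat)"
proof -
  have "real (\<Sum>m = 1..N. N div m\<^sup>2) \<le> (\<Sum>m = 1..N. real N * (1 / (real m)\<^sup>2))"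
    unfolding of_nat_sum
  proof (rule sum_mono)
    show "real (N div m\<^sup>2) \<le> real N * (1 / (real m)\<^sup>2)" for m
      using of_nat_div_le_of_nat[of N "m\<^sup>2", where 'a = real] by simp
  qed
  also have "\<dots> \<le> real N * 2"
    unfolding sum_distrib_left[symmetric] by (intro mult_left_mono sum_inverse_squares_le) auto
  finally show ?thesis by linarith
qed

lemma of_nat_div_gt_diff_1: "real m / real n - 1 < real (m div n)"
  using real_of_int_floor_gt_diff_one[of "real m / real n"] by (simp add: floor_divide_of_nat_eq)

text \<open>The difference \<open>harm n - ln n\<close> decreases from its value 1 at
  \<open>n = 1\<close>; the sequence is indexed from 0, hence \<open>N - 1\<close>.\<close>

lemma harm_le_ln_plus_1: "N \<ge> 1 \<Longrightarrow> harm N \<le> ln (real N) + 1"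
  using decseq_harm_diff_ln[THEN decseqD, of 0 "N - 1"] by (simp add: harm_expand)

text \<open>Removing the floors turns the sum into \<open>N * harm N\<close> at a cost of at most 1
  per term.\<close>

lemma sum_div_bounds:
  assumes "N \<ge> 1"
  shows "real N * ln (real N) - real N \<le> real (\<Sum>m = 1..N. N div m)"
    and "real (\<Sum>m = 1..N. N div m) \<le> real N * ln (real N) + real N"
proof -
  have h: "(\<Sum>m = 1..N. real N / real m) = real N * harm N"
    by (simp add: harm_def sum_distrib_left divide_inverse)
  have "real N * ln (real N) \<le> real N * harm N"
    using ln_le_harm[of N] assms by (intro mult_left_mono) (auto intro: order_trans[OF _ ln_le_harm])
  moreover have "real N * harm N - real N = (\<Sum>m = 1..N. real N / real m - 1)"
    unfolding sum_subtractf h by simp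
  moreover have "\<dots> \<le> (\<Sum>m = 1..N. real (N div m))"
    by (intro sum_mono of_nat_div_gt_diff_1[THEN less_imp_le])
  ultimately show "real N * ln (real N) - real N \<le> real (\<Sum>m = 1..N. N div m)" by simp
  have "real (\<Sum>m = 1..N. N div m) \<le> real N * harm N"
    unfolding h[symmetric] of_nat_sum by (intro sum_mono of_nat_div_le_of_nat)
  also have "\<dots> \<le> real N * (ln (real N) + 1)"
    using harm_le_ln_plus_1[OF assms] by (intro mult_left_mono) auto
  finally show "real (\<Sum>m = 1..N. N div m) \<le> real N * ln (real N) + real N" by (simp add: algebra_simps)
qed

section \<open>Upper and lower bounds for the count\<close>

definition degenerate_triples :: "nat \<Rightarrow> (int \<times> int \<times> int) set" where
  "degenerate_triples H = {(a1, a2, a3). \<bar>a1\<bar> \<le> int H \<and> \<bar>a2\<bar> \<le> int H \<and> \<bar>a3\<bar> \<le> int H \<and>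
     degenerate (map_poly of_int [:a3, a2, a1, 1:])}"

lemma finite_degenerate_triples: "finite (degenerate_triples H)"
  by (rule finite_subset[of _ "{- int H..int H} \<times> {- int H..int H} \<times> {- int H..int H}"])
     (auto simp: degenerate_triples_def)

lemma D3_eq_card: "D3 H = card (degenerate_triples H)"
proof -
  have "{[:a3, a2, a1, 1:] :: int poly | a1 a2 a3.
     \<bar>a1\<bar> \<le> int H \<and> \<bar>a2\<bar> \<le> int H \<and> \<bar>a3\<bar> \<le> int H \<and>
     degenerate (map_poly of_int [:a3, a2, a1, 1:])} = (\<lambda>(a1, a2, a3). [:a3, a2, a1, 1:]) ` degenerate_triples H"
    unfolding degenerate_triples_def image_def by auto
  moreover have "inj_on (\<lambda>(a1, a2, a3). [:a3, a2, a1, 1:] :: int poly) (degenerate_triples H)"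
    by (auto simp: inj_on_def)
  ultimately show ?thesis unfolding D3_def by (simp only: card_image)
qed

text \<open>The polynomial is \<open>(X + c) (X^2 + q)\<close>, and the two square roots of
  \<open>-q\<close> form a degenerate pair with exponent 2.\<close>

lemma degenerate_opposite_roots:
  fixes c q :: int
  assumes "q \<noteq> 0"
  shows "degenerate (map_poly of_int [:c * q, q, c, 1:])"
proof -
  define x where "x = csqrt (- of_int q)"
  have x2: "x\<^sup>2 = - of_int q" by (simp add: x_def)
  have "x \<noteq> 0" using assms by (simp add: x_def)
  have "x ^ 3 + of_int c * x\<^sup>2 + of_int q * x + of_int (c * q) = 0"
    using x2 unfolding of_int_mult by algebra
  moreover have "(- x) ^ 3 + of_int c * (- x)\<^sup>2 + of_int q * (- x) + of_int (c * q) = 0"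
    using x2 unfolding of_int_mult by algebra
  moreover have "x \<noteq> - x" "- x \<noteq> 0" "x ^ 2 = (- x) ^ 2" using \<open>x \<noteq> 0\<close> by auto
  ultimately show ?thesis unfolding degenerate_int_cubic_iff using one_le_numeral by blast
qed

text \<open>These are the coefficient triples of \<open>(X + c) (X\<^sup>2 + q)\<close>; the factor \<open>X\<^sup>2 + q\<close> has opposite roots.\<close>
definition hyperbola_triples :: "nat \<Rightarrow> (int \<times> int \<times> int) set" where
  "hyperbola_triples H = (\<lambda>(c, q). (c, q, c * q)) ` {(c, q). c \<noteq> 0 \<and> q \<noteq> 0 \<and> int (nat \<bar>c\<bar>) * \<bar>q\<bar> \<le> int H}"

lemma card_hyperbola_triples: "card (hyperbola_triples H) = 4 * (\<Sum>m = 1..H. H div m)"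
  unfolding hyperbola_triples_def
  by (subst card_image) (auto simp: inj_on_def card_pairs_below_hyperbola[of "\<lambda>m. m", simplified])

lemma hyperbola_triples_subset: "hyperbola_triples H \<subseteq> degenerate_triples H"
proof -
  have "\<bar>c\<bar> \<le> int H \<and> \<bar>q\<bar> \<le> int H \<and> \<bar>c * q\<bar> \<le> int H"
    if "c \<noteq> 0" "q \<noteq> 0" "\<bar>c\<bar> * \<bar>q\<bar> \<le> int H" for c q :: int
  proof -
    \<comment> \<open>Both factors are at least 1 in absolute value, so the bound on the product
      already bounds each of them.\<close>
    have "\<bar>c\<bar> * 1 \<le> \<bar>c\<bar> * \<bar>q\<bar>" "1 * \<bar>q\<bar> \<le> \<bar>c\<bar> * \<bar>q\<bar>" using that by (intro mult_mono; simp)+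
    then show ?thesis using that(3) unfolding abs_mult by linarith
  qed
  then show ?thesis
    unfolding hyperbola_triples_def degenerate_triples_def by (auto intro: degenerate_opposite_roots)
qed

lemma D3_lower: "4 * (\<Sum>m = 1..H. H div m) \<le> D3 H"
  unfolding D3_eq_card card_hyperbola_triples[symmetric]
  by (intro card_mono finite_degenerate_triples hyperbola_triples_subset)

text \<open>The sets with two zero entries collect \<open>X^3 + a3\<close> and the solutions of
  \<open>a1 * a2 = a3\<close> with a vanishing factor. In the last family \<open>q\<close> is
  recovered as \<open>p\<^sup>2 div k\<close>, and \<open>k * a3 = p\<^sup>2 * c\<close> yields
  membership in \<open>S\<close>; if \<open>p\<close> or \<open>c\<close> is 0, the other one equals
  \<open>a1\<close>.\<close>

lemma degenerate_triples_cover: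
  fixes H :: nat
  defines "I \<equiv> {- int H..int H}"
    and "S \<equiv> {(p, c). p \<noteq> 0 \<and> c \<noteq> 0 \<and> int ((nat \<bar>p\<bar>)\<^sup>2) * \<bar>c\<bar> \<le> int (3 * H)}"
  shows "degenerate_triples H \<subseteq> hyperbola_triples H \<union>
    ({0} \<times> {0} \<times> I \<union> {0} \<times> I \<times> {0} \<union> I \<times> {0} \<times> {0}) \<union>
    (\<lambda>(k, p, c). (c + p, c * p + p\<^sup>2 div k, c * (p\<^sup>2 div k))) ` ({1, 2, 3} \<times> ({0} \<times> I \<union> I \<times> {0} \<union> S))"
    (is "_ \<subseteq> ?A \<union> ?E \<union> ?F ` ?G")
proof
  fix t assume "t \<in> degenerate_triples H"
  then obtain a1 a2 a3 where t: "t = (a1, a2, a3)" and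
    bounds: "\<bar>a1\<bar> \<le> int H" "\<bar>a2\<bar> \<le> int H" "\<bar>a3\<bar> \<le> int H" and
    deg: "degenerate (map_poly of_int [:a3, a2, a1, 1:])"
    unfolding degenerate_triples_def by blast
  from deg consider "a1 = 0" "a2 = 0" | "a1 * a2 = a3" |
    c p q k where "k \<in> {1, 2, 3}" "p\<^sup>2 = k * q" "a1 = c + p" "a2 = c * p + q" "a3 = c * q"
    unfolding degenerate_int_cubic_iff by (metis degenerate_cubic_classification)
  then show "t \<in> ?A \<union> ?E \<union> ?F ` ?G"
  proof cases
    case 1
    then show ?thesis using bounds by (auto simp: t I_def)
  next
    case 2
    show ?thesis
    proof (cases "a1 = 0 \<or> a2 = 0")
      case True
      then show ?thesis using 2 bounds by (auto simp: t I_def)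
    next
      case False
      then have "t \<in> ?A" using 2 bounds unfolding hyperbola_triples_def t
        by (auto simp flip: abs_mult)
      then show ?thesis by blast
    qed
  next
    case (3 c p q k)
    have q: "q = p\<^sup>2 div k" using 3(1,2) by auto
    have "p\<^sup>2 * \<bar>c\<bar> = \<bar>p\<^sup>2 * c\<bar>" by (simp add: abs_mult)
    also have "\<dots> = \<bar>k * a3\<bar>" unfolding 3(2,5) by (simp add: mult_ac)
    also have "\<dots> = k * \<bar>a3\<bar>" using 3(1) by (auto simp: abs_mult)
    also have "\<dots> \<le> 3 * int H" using 3(1) bounds(3) by (intro mult_mono) auto
    finally have "p\<^sup>2 * \<bar>c\<bar> \<le> 3 * int H" .
    then have "(p, c) \<in> {0} \<times> I \<union> I \<times> {0} \<union> S" using 3 bounds(1) by (auto simp: I_def S_def)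
    then have "(k, p, c) \<in> ?G" using 3(1) by blast
    moreover have "t = ?F (k, p, c)" unfolding t 3(3-5) q by simp
    ultimately show ?thesis by blast
  qed
qed

lemma D3_upper: "D3 H \<le> 4 * (\<Sum>m = 1..H. H div m) + 90 * H + 9"
proof -
  define I where "I = {- int H..int H}"
  define S where "S = {(p, c). p \<noteq> 0 \<and> c \<noteq> 0 \<and> int ((nat \<bar>p\<bar>)\<^sup>2) * \<bar>c\<bar> \<le> int (3 * H)}"
  define E where "E = {0 :: int} \<times> {0 :: int} \<times> I \<union> {0} \<times> I \<times> {0} \<union> I \<times> {0} \<times> {0}"
  define G where "G = {1, 2, 3 :: int} \<times> ({0} \<times> I \<union> I \<times> {0} \<union> S)"
  define F where "F = (\<lambda>(k, p, c). (c + p, c * p + p\<^sup>2 div k, c * (p\<^sup>2 div k)) :: int \<times> int \<times> int)"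
  have I: "finite I" "card I = 2 * H + 1" by (auto simp: I_def)
  have "m \<le> m\<^sup>2" for m :: nat by (simp add: power2_eq_square)
  note S = card_pairs_below_hyperbola[of "\<lambda>m. m\<^sup>2" "3 * H", OF this, folded S_def]
  \<comment> \<open>24 = 4 * 2 * 3: four signs, the bound 2 for the inverse squares, and
    \<open>N = 3 * H\<close>.\<close>
  have cS: "card S \<le> 24 * H" using S(2) sum_div_squares_le[of "3 * H"] by simp
  have cE: "card E \<le> 3 * (2 * H + 1)"
  proof -
    have "card E \<le> card ({0 :: int} \<times> {0 :: int} \<times> I) + card ({0 :: int} \<times> I \<times> {0 :: int}) + card (I \<times> {0 :: int} \<times> {0 :: int})"
      unfolding E_def by (meson add_le_mono1 card_Un_le order_trans)
    then show ?thesis by (simp add: card_cartesian_product I)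
  qed
  have "card ({0} \<times> I \<union> I \<times> {0} \<union> S) \<le> card ({0 :: int} \<times> I) + card (I \<times> {0 :: int}) + card S"
    by (meson add_le_mono1 card_Un_le order_trans)
  then have cG: "card G \<le> 3 * (2 * (2 * H + 1) + 24 * H)"
    using cS unfolding G_def card_cartesian_product by (simp add: card_cartesian_product I)
  have "finite G" "finite E" using I S(1) by (auto simp: G_def E_def)
  have "finite (hyperbola_triples H)"
    using finite_degenerate_triples hyperbola_triples_subset finite_subset by blast
  have "D3 H \<le> card (hyperbola_triples H \<union> E \<union> F ` G)"
    unfolding D3_eq_card
  proof (rule card_mono)
    show "finite (hyperbola_triples H \<union> E \<union> F ` G)"
      using \<open>finite G\<close> \<open>finite E\<close> \<open>finite (hyperbola_triples H)\<close> by simp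
    show "degenerate_triples H \<subseteq> hyperbola_triples H \<union> E \<union> F ` G"
      unfolding F_def G_def E_def I_def S_def by (rule degenerate_triples_cover)
  qed
  also have "\<dots> \<le> card (hyperbola_triples H) + card E + card (F ` G)"
    by (meson add_le_mono1 card_Un_le order_trans)
  also have "\<dots> \<le> 4 * (\<Sum>m = 1..H. H div m) + 3 * (2 * H + 1) + 3 * (2 * (2 * H + 1) + 24 * H)"
    using card_image_le[OF \<open>finite G\<close>, of F] cE cG unfolding card_hyperbola_triples by linarith
  also have "\<dots> = 4 * (\<Sum>m = 1..H. H div m) + 90 * H + 9" by simp
  finally show ?thesis .
qed

section \<open>Passage to the limit\<close>

theorem theorem6p2:
  shows "(\<lambda>H. real (D3 H) / (real H * ln (real H))) \<longlonglongrightarrow> 4"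
proof -
  \<comment> \<open>The upper bound exceeds \<open>4 * H * ln H\<close> by at most
    \<open>4 * H + 90 * H + 9\<close>, which is at most \<open>103 * H\<close>; the lower bound
    loses only \<open>4 * H\<close>. Taking \<open>H \<ge> 2\<close> makes \<open>ln H\<close>
    positive.\<close>
  have bound: "norm (real (D3 H) / (real H * ln (real H)) - 4) \<le> 103 / ln (real H)" if "H \<ge> 2" for H
  proof -
    have pos: "real H > 0" "ln (real H) > 0" using that by auto
    have "real (D3 H) \<le> 4 * real (\<Sum>m = 1..H. H div m) + 90 * real H + 9"
      using D3_upper[of H] by linarith
    moreover have "4 * real (\<Sum>m = 1..H. H div m) \<le> real (D3 H)"
      using D3_lower[of H] by linarith
    ultimately have "\<bar>real (D3 H) - 4 * (real H * ln (real H))\<bar> \<le> 103 * real H"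
      using sum_div_bounds[of H] that by linarith
    then have "\<bar>real (D3 H) - 4 * (real H * ln (real H))\<bar> / (real H * ln (real H)) \<le> 103 * real H / (real H * ln (real H))"
      using pos by (intro divide_right_mono) auto
    moreover have "real (D3 H) / (real H * ln (real H)) - 4 =
        (real (D3 H) - 4 * (real H * ln (real H))) / (real H * ln (real H))"
      using pos by (simp add: field_simps)
    ultimately show ?thesis using pos by (simp add: abs_mult)
  qed
  have "(\<lambda>H. 103 / ln (real H)) \<longlonglongrightarrow> 0"
    by (intro tendsto_divide_0[OF tendsto_const] filterlim_at_top_imp_at_infinity
        filterlim_compose[OF ln_at_top filterlim_real_sequentially])
  then have "(\<lambda>H. real (D3 H) / (real H * ln (real H)) - 4) \<longlonglongrightarrow> 0"
    by (rule Lim_null_comparison[rotated]) (use bound in \<open>auto simp: eventually_sequentially\<close>)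
  then show ?thesis by (simp add: LIM_zero_iff)
qed

end
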